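(* Let $\mathbb{F}$ be a commutative Artinian ring, let $R=\mathbb{F}[x_1,\dots,x_n]$, and let $X=\{P_1,\dots,P_r\}$ be a set of $r$ distinct points in $\mathbb{F}^n$. For each $i\in\{1,\dots,r\}$ let $I_i\subset R$ be an ideal that covers $X\setminus\{P_i\}$. Let $d=\max_{1\le i\le r} g(I_i)$. If $$r\ge \operatorname{length}(\mathbb{F})\binom{n+d}{d}+1,$$ then at least one of the ideals $I_i$ covers $X$.
   Context: For a set $X\subset\mathbb{F}^n$, $I(X)\subset R$ is the ideal of polynomials vanishing at every point of $X$. An $\mathbb{F}$-submodule $Y$ of $R$ (in particular, an ideal) covers $X$ if $Y\subset I(X)$. For an ideal $I\subset R$, $g(I)$ is the infimum, over all finite systems of generators $G$ of $I$, of the maximal (total) degree of the polynomials in $G$ (with the convention $g(0)=0$). $\operatorname{length}(\mathbb{F})$ is the length of $\mathbb{F}$ as a module over itself, i.e. the supremum of lengths of chains of submodules (ideals); it is finite since $\mathbb{F}$ is Artinian. *)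

theory Defs
  imports
    "HOL-Algebra.Ideal"
    "HOL-Library.Poly_Mapping"
    "HOL-Library.Extended_Nat"
begin

text \<open>
  The sort \<open>{comm_ring, comm_monoid_mult}\<close> is that of commutative rings with 1 in which
  0 = 1 is allowed; \<open>comm_ring_1\<close> would exclude the zero ring. Ideals are those of HOL-Algebra.
\<close>

definition coeff_ring :: "'a::{comm_ring, comm_monoid_mult} ring" where
  "coeff_ring = \<lparr>carrier = UNIV, monoid.mult = (*), one = 1, ring.zero = 0, add = (+)\<rparr>"

type_synonym 'a mpoly = "(nat \<Rightarrow>\<^sub>0 nat) \<Rightarrow>\<^sub>0 'a"

text \<open>
  The ring of polynomials in the variables with indices \<open>1, \<dots>, n\<close>. A monomial is its exponent
  function. The unit is written as \<open>single 0 1\<close> because the class instance of \<open>1\<close> for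
  \<open>\<Rightarrow>\<^sub>0\<close> needs 0 and 1 to be distinct in the coefficients.
\<close>

definition mpoly_ring :: "nat \<Rightarrow> 'a::{comm_ring, comm_monoid_mult} mpoly ring" where
  "mpoly_ring n = \<lparr>carrier = {p. \<forall>m\<in>Poly_Mapping.keys p. Poly_Mapping.keys m \<subseteq> {1..n}},
     monoid.mult = (*), one = Poly_Mapping.single 0 1, ring.zero = 0, add = (+)\<rparr>"

definition affine_space :: "nat \<Rightarrow> (nat \<Rightarrow> 'a) set" where
  "affine_space n = {1..n} \<rightarrow>\<^sub>E UNIV"

definition eval_mpoly :: "(nat \<Rightarrow> 'a) \<Rightarrow> 'a::{comm_ring, comm_monoid_mult} mpoly \<Rightarrow> 'a" where
  "eval_mpoly x p =
     (\<Sum>m\<in>Poly_Mapping.keys p.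
        Poly_Mapping.lookup p m * (\<Prod>j\<in>Poly_Mapping.keys m. x j ^ Poly_Mapping.lookup m j))"

definition monom_degree :: "(nat \<Rightarrow>\<^sub>0 nat) \<Rightarrow> nat" where
  "monom_degree m = (\<Sum>j\<in>Poly_Mapping.keys m. Poly_Mapping.lookup m j)"

text \<open>The zero polynomial gets total degree 0.\<close>

definition total_degree :: "'a::zero mpoly \<Rightarrow> nat" where
  "total_degree p = Max (insert 0 (monom_degree ` Poly_Mapping.keys p))"

definition vanishing_ideal ::
    "nat \<Rightarrow> (nat \<Rightarrow> 'a) set \<Rightarrow> 'a::{comm_ring, comm_monoid_mult} mpoly set" where
  "vanishing_ideal n X = {p \<in> carrier (mpoly_ring n). \<forall>x\<in>X. eval_mpoly x p = 0}"

definition covers ::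
    "nat \<Rightarrow> 'a::{comm_ring, comm_monoid_mult} mpoly set \<Rightarrow> (nat \<Rightarrow> 'a) set \<Rightarrow> bool" where
  "covers n Y X \<longleftrightarrow> Y \<subseteq> vanishing_ideal n X"

text \<open>
  The maximum over a generating system is a supremum in \<open>enat\<close>, which is 0 for the empty
  system; hence the value at the zero ideal is 0. The infimum is \<open>\<infinity>\<close> if there is no finite
  generating system.
\<close>

definition gen_degree :: "nat \<Rightarrow> 'a::{comm_ring, comm_monoid_mult} mpoly set \<Rightarrow> enat" where
  "gen_degree n I =
     (INF G \<in> {G. finite G \<and> G \<subseteq> carrier (mpoly_ring n) \<and> genideal (mpoly_ring n) G = I}.
        SUP p\<in>G. enat (total_degree p))"

definition artinian_ring :: "('a, 'b) ring_scheme \<Rightarrow> bool" where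
  "artinian_ring R \<longleftrightarrow>
     ring R \<and> (\<forall>J :: nat \<Rightarrow> 'a set. (\<forall>k. ideal (J k) R) \<and> antimono J \<longrightarrow> (\<exists>N. \<forall>k\<ge>N. J k = J N))"

text \<open>
  A finite chain consisting of \<open>k + 1\<close> ideals has length \<open>k\<close>; finite chains suffice, as an
  infinite chain contains finite chains of every length.
\<close>

definition ring_length :: "('a, 'b) ring_scheme \<Rightarrow> enat" where
  "ring_length R =
     (SUP C \<in> {C. finite C \<and> C \<noteq> {} \<and> subset.chain {I. ideal I R} C}. enat (card C - 1))"

lemma cring_coeff_ring: "cring (coeff_ring :: 'a::{comm_ring, comm_monoid_mult} ring)"
proof (intro cringI abelian_groupI comm_monoidI)
  fix x :: 'a
  show "\<exists>y\<in>carrier coeff_ring. y \<oplus>\<^bsub>coeff_ring\<^esub> x = \<zero>\<^bsub>coeff_ring\<^esub>"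
    by (rule bexI[of _ "- x"]) (simp_all add: coeff_ring_def)
qed (simp_all add: coeff_ring_def ac_simps distrib_left)

lemma single_0_1_times:
  "Poly_Mapping.single 0 1 * p = (p :: 'a::{comm_ring, comm_monoid_mult} mpoly)"
  by transfer (simp add: prod_fun_def [abs_def] when_mult)

lemma cring_mpoly_ring: "cring (mpoly_ring n :: 'a::{comm_ring, comm_monoid_mult} mpoly ring)"
proof -
  let ?C = "carrier (mpoly_ring n) :: 'a mpoly set"
  have C: "p \<in> ?C \<longleftrightarrow> (\<forall>m\<in>Poly_Mapping.keys p. Poly_Mapping.keys m \<subseteq> {1..n})" for p
    by (simp add: mpoly_ring_def)
  have add: "p + q \<in> ?C" if "p \<in> ?C" "q \<in> ?C" for p q
    using that Poly_Mapping.keys_add[of p q] unfolding C by blast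
  have mult: "p * q \<in> ?C" if "p \<in> ?C" "q \<in> ?C" for p q
    unfolding C
  proof (intro ballI subsetI)
    fix m j assume "m \<in> Poly_Mapping.keys (p * q)" "j \<in> Poly_Mapping.keys m"
    then obtain a b where "a \<in> Poly_Mapping.keys p" "b \<in> Poly_Mapping.keys q"
      "j \<in> Poly_Mapping.keys (a + b)"
      using keys_mult[of p q] by blast
    then show "j \<in> {1..n}"
      using that Poly_Mapping.keys_add[of a b] unfolding C by blast
  qed
  have neg: "- p \<in> ?C" if "p \<in> ?C" for p
    using that by (simp add: C)
  have one: "Poly_Mapping.single 0 1 \<in> ?C"
    by (simp add: C)
  have zero: "0 \<in> ?C"
    by (simp add: C)
  have ops: "mult (mpoly_ring n) = ((*) :: 'a mpoly \<Rightarrow> _)" "add (mpoly_ring n) = ((+) :: 'a mpoly \<Rightarrow> _)"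
    "\<one>\<^bsub>mpoly_ring n\<^esub> = (Poly_Mapping.single 0 1 :: 'a mpoly)" "\<zero>\<^bsub>mpoly_ring n\<^esub> = (0 :: 'a mpoly)"
    by (simp_all add: mpoly_ring_def)
  have unit: "Poly_Mapping.single 0 1 * p = p" "p * Poly_Mapping.single 0 1 = p" for p :: "'a mpoly"
    by (simp_all only: single_0_1_times mult.commute[of p])
  show ?thesis
  proof (intro cringI abelian_groupI comm_monoidI)
    fix p assume "p \<in> ?C"
    then show "\<exists>q\<in>?C. q \<oplus>\<^bsub>mpoly_ring n\<^esub> p = \<zero>\<^bsub>mpoly_ring n\<^esub>"
      by (intro bexI[of _ "- p"]) (simp_all add: ops neg)
  qed (simp_all add: ops add mult one zero unit ac_simps distrib_left)
qed

end

theory Submission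
  imports Defs
begin

text \<open>
  If no \<open>I i\<close> covers all the points, then each has a generator \<open>f i\<close> of degree at most \<open>d\<close> that
  vanishes at all points but \<open>P i\<close>. Hence the modules of polynomials of degree at most \<open>d\<close> that
  vanish at \<open>P j\<close> for all \<open>j > s\<close> strictly increase with \<open>s\<close>, for \<open>s = 0, \<dots>, r\<close>. In a free module
  of rank \<open>N\<close>, a submodule that strictly increases makes one of its \<open>N\<close> leading coefficient ideals
  strictly increase, so a strict chain has length at most \<open>N\<close> times the length of the ring.
\<close>

section \<open>Chains of ideals with repetitions\<close>

lemma card_strict_steps_le_ring_length:
  fixes J :: "nat \<Rightarrow> 'b set"
  assumes ideals: "\<And>s. ideal (J s) R" and "mono J"
  shows "enat (card {s. s < r \<and> J s \<noteq> J (Suc s)}) \<le> ring_length R"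
proof -
  let ?T = "{s. s < r \<and> J s \<noteq> J (Suc s)}" and ?C = "J ` {..r}"
  have step: "J s \<subset> J t" if "s \<in> ?T" "s < t" for s t
  proof -
    have "J s \<subset> J (Suc s)"
      using that monoD[OF \<open>mono J\<close>, of s "Suc s"] by auto
    then show ?thesis
      using monoD[OF \<open>mono J\<close>, of "Suc s" t] that by auto
  qed
  have "inj_on (\<lambda>s. J (Suc s)) ?T"
  proof (rule linorder_inj_onI)
    fix s t assume "s < t" "s \<in> ?T" "t \<in> ?T"
    then show "J (Suc s) \<noteq> J (Suc t)"
      using step[of t "Suc t"] monoD[OF \<open>mono J\<close>, of "Suc s" t] by auto
  qed auto
  moreover have "J (Suc s) \<noteq> J 0" if "s \<in> ?T" for s
    using step[OF that, of "Suc s"] monoD[OF \<open>mono J\<close>, of 0 s] by auto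
  then have "(\<lambda>s. J (Suc s)) ` ?T \<subseteq> ?C - {J 0}"
    by auto
  ultimately have "card ?T \<le> card (?C - {J 0})"
    by (intro card_inj_on_le) auto
  also have "\<dots> = card ?C - 1"
    by (simp add: card_Diff_singleton)
  finally have "enat (card ?T) \<le> enat (card ?C - 1)"
    by simp
  also have "\<dots> \<le> ring_length R"
    unfolding ring_length_def
  proof (rule SUP_upper)
    have "subset.chain {I. ideal I R} ?C"
      unfolding subset_chain_def using ideals monoD[OF \<open>mono J\<close>] nat_le_linear by blast
    then show "?C \<in> {C. finite C \<and> C \<noteq> {} \<and> subset.chain {I. ideal I R} C}"
      by auto
  qed
  finally show ?thesis .
qed

section \<open>Submodules of free modules and their leading coefficients\<close>

text \<open>The entry \<open>v k\<close> may itself be 0. This keeps the set closed under addition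
  when leading terms cancel.\<close>

definition leading_coeffs :: "('i::linorder \<Rightarrow> 'a::zero) set \<Rightarrow> 'i \<Rightarrow> 'a set" where
  "leading_coeffs M k = {v k |v. v \<in> M \<and> (\<forall>l>k. v l = 0)}"

lemma leading_coeffs_mono: "M \<subseteq> M' \<Longrightarrow> leading_coeffs M k \<subseteq> leading_coeffs M' k"
  unfolding leading_coeffs_def by blast

text \<open>Vectors are functions on the index type; finite rank enters later through a finite set
  \<open>S\<close> that contains all supports. Negatives come from the scalar
  \<open>- 1\<close>.\<close>

definition submodule_fun :: "('i \<Rightarrow> 'a::{comm_ring, comm_monoid_mult}) set \<Rightarrow> bool" where
  "submodule_fun M \<longleftrightarrow> (\<lambda>_. 0) \<in> M \<and> (\<forall>v\<in>M. \<forall>w\<in>M. (\<lambda>i. v i + w i) \<in> M) \<and>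
     (\<forall>c. \<forall>v\<in>M. (\<lambda>i. c * v i) \<in> M)"

lemma submodule_funD:
  assumes "submodule_fun M"
  shows "(\<lambda>_. 0) \<in> M" and "v \<in> M \<Longrightarrow> w \<in> M \<Longrightarrow> (\<lambda>i. v i + w i) \<in> M"
    and "v \<in> M \<Longrightarrow> (\<lambda>i. c * v i) \<in> M"
  using assms by (auto simp: submodule_fun_def)

lemma ideal_leading_coeffs:
  fixes M :: "('i::linorder \<Rightarrow> 'a::{comm_ring, comm_monoid_mult}) set"
  assumes "submodule_fun M"
  shows "ideal (leading_coeffs M k) (coeff_ring :: 'a ring)"
proof -
  let ?L = "leading_coeffs M k"
  interpret cring "coeff_ring :: 'a ring"
    by (rule cring_coeff_ring)
  have I: "v k \<in> ?L" if "v \<in> M" "\<forall>l>k. v l = 0" for v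
    using that unfolding leading_coeffs_def by blast
  have zero: "0 \<in> ?L"
    using I[of "\<lambda>_. 0"] assms by (simp add: submodule_fun_def)
  have add: "a + b \<in> ?L" if ab: "a \<in> ?L" "b \<in> ?L" for a b
  proof -
    obtain v w where "v \<in> M" "\<forall>l>k. v l = 0" "a = v k" "w \<in> M" "\<forall>l>k. w l = 0" "b = w k"
      using ab unfolding leading_coeffs_def by blast
    then show ?thesis
      using I[of "\<lambda>i. v i + w i"] assms by (simp add: submodule_fun_def)
  qed
  have mult: "c * a \<in> ?L" if a: "a \<in> ?L" for a c
  proof -
    obtain v where "v \<in> M" "\<forall>l>k. v l = 0" "a = v k"
      using a unfolding leading_coeffs_def by blast
    then show ?thesis
      using I[of "\<lambda>i. c * v i"] assms by (simp add: submodule_fun_def)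
  qed
  have neg: "- a \<in> ?L" if a: "a \<in> ?L" for a
    using mult[OF a, of "- 1"] by simp
  have inv: "\<ominus>\<^bsub>coeff_ring\<^esub> a = - a" for a :: 'a
    by (rule minus_equality) (simp_all add: coeff_ring_def)
  show ?thesis
  proof (rule idealI)
    show "subgroup ?L (add_monoid coeff_ring)"
    proof (rule add.subgroupI)
      show "?L \<subseteq> carrier coeff_ring"
        by (simp add: coeff_ring_def)
      show "?L \<noteq> {}"
        using zero by blast
      show "\<ominus>\<^bsub>coeff_ring\<^esub> a \<in> ?L" if "a \<in> ?L" for a
        using neg[OF that] by (simp add: inv)
      show "a \<oplus>\<^bsub>coeff_ring\<^esub> b \<in> ?L" if "a \<in> ?L" "b \<in> ?L" for a b
        using add[OF that] by (simp add: coeff_ring_def)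
    qed
  next
    fix a c assume "a \<in> ?L"
    then show "c \<otimes>\<^bsub>coeff_ring\<^esub> a \<in> ?L" "a \<otimes>\<^bsub>coeff_ring\<^esub> c \<in> ?L"
      using mult[of a c] by (simp_all add: coeff_ring_def mult.commute)
  qed (rule ring_axioms)
qed

text \<open>A reduction as in Gaussian elimination: subtracting from a vector of \<open>M'\<close> a
  vector of \<open>M\<close> with the same leading coefficient pushes the leading position down, and
  after finitely many rounds nothing is left.\<close>

lemma submodule_eq_if_leading_coeffs_eq:
  fixes M M' :: "('i::linorder \<Rightarrow> 'a::{comm_ring, comm_monoid_mult}) set"
  assumes M: "submodule_fun M" and M': "submodule_fun M'" and sub: "M \<subseteq> M'"
    and fin: "finite S" and supp: "\<And>v i. v \<in> M' \<Longrightarrow> v i \<noteq> 0 \<Longrightarrow> i \<in> S"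
    and eq: "\<And>k. k \<in> S \<Longrightarrow> leading_coeffs M' k = leading_coeffs M k"
  shows "M = M'"
proof -
  \<comment> \<open>\<open>T\<close> bounds the support of \<open>v\<close> and is an initial
    segment of \<open>S\<close>. The latter matters because the subtracted vector may bring in any
    position of \<open>S\<close> below the leading one.\<close>
  have "v \<in> M" if "finite T" "T \<subseteq> S" "\<And>t i. t \<in> T \<Longrightarrow> i \<in> S \<Longrightarrow> i \<le> t \<Longrightarrow> i \<in> T"
    "v \<in> M'" "\<And>i. v i \<noteq> 0 \<Longrightarrow> i \<in> T" for T v
    using that
  proof (induction T arbitrary: v rule: finite_linorder_max_induct)
    case empty
    then have "v = (\<lambda>_. 0)"
      by auto
    then show ?case
      using M by (simp add: submodule_fun_def)
  next
    case (insert k T)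
    have "\<forall>l>k. v l = 0"
      using insert.hyps insert.prems(4) by fastforce
    then have "v k \<in> leading_coeffs M' k"
      using insert.prems(3) unfolding leading_coeffs_def by blast
    then have "v k \<in> leading_coeffs M k"
      using eq insert.prems(1) by auto
    then obtain w where w: "w \<in> M" "\<forall>l>k. w l = 0" "w k = v k"
      unfolding leading_coeffs_def by auto
    \<comment> \<open>The entries at \<open>k\<close> cancel and both vectors vanish above
      \<open>k\<close>, so the support of \<open>?u\<close> lies strictly below \<open>k\<close>,
      hence in \<open>T\<close>.\<close>
    let ?u = "\<lambda>i. v i + - 1 * w i"
    have "(\<lambda>i. - 1 * w i) \<in> M'"
      using w(1) sub by (intro submodule_funD(3)[OF M']) auto
    then have u: "?u \<in> M'"
      by (rule submodule_funD(2)[OF M' insert.prems(3)])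
    have "i \<in> T" if "?u i \<noteq> 0" for i
    proof -
      have "i \<in> S"
        using supp[OF u that] .
      moreover have "i < k"
        using that w \<open>\<forall>l>k. v l = 0\<close> by (cases i k rule: linorder_cases) auto
      ultimately show ?thesis
        using insert.prems(2)[of k i] by (metis insert_iff less_imp_le less_irrefl)
    qed
    moreover have "i \<in> T" if "t \<in> T" "i \<in> S" "i \<le> t" for t i
      using insert.prems(2)[of t i] insert.hyps(2) that by force
    ultimately have "?u \<in> M"
      using insert.IH[OF _ _ u] insert.prems(1) by blast
    then have "(\<lambda>i. ?u i + w i) \<in> M"
      using w(1) by (rule submodule_funD(2)[OF M])
    then show ?case
      by simp
  qed
  from this[of S] show ?thesis
    using sub supp fin by blast
qed

text \<open>A union bound: every strict step of the modules is a strict step of the leading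
  coefficient ideals at some position in \<open>S\<close>, and each position accounts for at most
  \<open>ring_length\<close> many steps.\<close>

lemma strict_submodule_chain_length_le:
  fixes M :: "nat \<Rightarrow> ('i::linorder \<Rightarrow> 'a::{comm_ring, comm_monoid_mult}) set"
  assumes sub: "\<And>s. submodule_fun (M s)" and "mono M"
    and strict: "\<And>s. s < r \<Longrightarrow> M s \<noteq> M (Suc s)"
    and fin: "finite S" and supp: "\<And>s v i. v \<in> M s \<Longrightarrow> v i \<noteq> 0 \<Longrightarrow> i \<in> S"
  shows "enat r \<le> ring_length (coeff_ring :: 'a ring) * enat (card S)"
proof -
  let ?T = "\<lambda>k. {s. s < r \<and> leading_coeffs (M s) k \<noteq> leading_coeffs (M (Suc s)) k}"
  have "\<exists>k\<in>S. s \<in> ?T k" if "s < r" for s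
  proof (rule ccontr)
    assume "\<not> ?thesis"
    then have "leading_coeffs (M (Suc s)) k = leading_coeffs (M s) k" if "k \<in> S" for k
      using that \<open>s < r\<close> by auto
    moreover have "M s \<subseteq> M (Suc s)"
      by (rule monoD[OF \<open>mono M\<close>]) simp
    ultimately have "M s = M (Suc s)"
      using supp by (intro submodule_eq_if_leading_coeffs_eq[OF sub sub _ fin]) auto
    then show False
      using strict[OF that] by simp
  qed
  then have "{..<r} \<subseteq> (\<Union>k\<in>S. ?T k)"
    by blast
  then have "card {..<r} \<le> card (\<Union>k\<in>S. ?T k)"
    using fin by (intro card_mono) auto
  also have "\<dots> \<le> (\<Sum>k\<in>S. card (?T k))"
    by (rule card_UN_le[OF fin])
  finally have "enat r \<le> (\<Sum>k\<in>S. enat (card (?T k)))"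
    by (simp add: of_nat_eq_enat[symmetric] del: of_nat_sum add: of_nat_sum[symmetric])
  also have "\<dots> \<le> (\<Sum>k\<in>S. ring_length (coeff_ring :: 'a ring))"
    by (intro sum_mono card_strict_steps_le_ring_length ideal_leading_coeffs sub monoI
        leading_coeffs_mono monoD[OF \<open>mono M\<close>])
  also have "\<dots> = ring_length (coeff_ring :: 'a ring) * enat (card S)"
    by (simp add: of_nat_eq_enat[symmetric] mult.commute)
  finally show ?thesis .
qed

section \<open>Counting monomials of bounded degree\<close>

definition monoms :: "nat \<Rightarrow> nat \<Rightarrow> (nat \<Rightarrow>\<^sub>0 nat) set" where
  "monoms n d = {m. Poly_Mapping.keys m \<subseteq> {1..n} \<and> monom_degree m \<le> d}"

text \<open>Stars and bars: the slack \<open>d - monom_degree m\<close> put in front of the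
  \<open>n\<close> exponents gives a list of \<open>n + 1\<close> naturals with sum
  \<open>d\<close>, from which the monomial can be recovered.\<close>

lemma finite_monoms: "finite (monoms n d)"
  and card_monoms_le: "card (monoms n d) \<le> (n + d) choose d"
proof -
  let ?L = "{l :: nat list. length l = n + 1 \<and> sum_list l = d}"
  let ?f = "\<lambda>m. (d - monom_degree m) # map (Poly_Mapping.lookup m) [1..<Suc n]"
  have card: "card ?L = (n + d) choose d"
    using card_length_sum_list[of "n + 1" d] by (simp add: add.commute)
  \<comment> \<open>An infinite set would have cardinality 0, but the binomial coefficient is
    positive.\<close>
  then have fin: "finite ?L"
    by (metis card_ge_0_finite le_add2 zero_less_binomial)
  have inj: "inj_on ?f (monoms n d)"
  proof (rule inj_onI, rule poly_mapping_eqI)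
    fix m m' j assume m: "m \<in> monoms n d" "m' \<in> monoms n d" "?f m = ?f m'"
    show "Poly_Mapping.lookup m j = Poly_Mapping.lookup m' j"
    proof (cases "j \<in> {1..n}")
      case True
      then show ?thesis
        using m(3) by (auto simp: map_eq_conv simp del: upt_Suc)
    next
      case False
      then have "j \<notin> Poly_Mapping.keys m" "j \<notin> Poly_Mapping.keys m'"
        using m unfolding monoms_def by auto
      then show ?thesis
        by (simp add: in_keys_iff)
    qed
  qed
  have "?f m \<in> ?L" if "m \<in> monoms n d" for m
  proof -
    have "(\<Sum>j\<leftarrow>[1..<Suc n]. Poly_Mapping.lookup m j) = (\<Sum>j\<in>{1..n}. Poly_Mapping.lookup m j)"
      by (simp add: interv_sum_list_conv_sum_set_nat atLeastLessThanSuc_atLeastAtMost del: upt_Suc)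
    also have "\<dots> = monom_degree m"
      unfolding monom_degree_def
      using that by (intro sum.mono_neutral_right) (auto simp: monoms_def in_keys_iff)
    \<comment> \<open>The truncated subtraction in the slack is exact because
      \<open>monom_degree m \<le> d\<close>.\<close>
    finally show ?thesis
      using that by (simp add: monoms_def del: upt_Suc)
  qed
  then have sub: "?f ` monoms n d \<subseteq> ?L"
    by (rule image_subsetI)
  show "finite (monoms n d)"
    by (rule inj_on_finite[OF inj sub fin])
  show "card (monoms n d) \<le> (n + d) choose d"
    using card_inj_on_le[OF inj sub fin] unfolding card .
qed

section \<open>Evaluation as a ring homomorphism\<close>

definition eval_monom :: "(nat \<Rightarrow> 'a) \<Rightarrow> (nat \<Rightarrow>\<^sub>0 nat) \<Rightarrow> 'a::comm_monoid_mult" where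
  "eval_monom x m = (\<Prod>j\<in>Poly_Mapping.keys m. x j ^ Poly_Mapping.lookup m j)"

lemma eval_monom_superset:
  assumes "finite A" "Poly_Mapping.keys m \<subseteq> A"
  shows "eval_monom x m = (\<Prod>j\<in>A. x j ^ Poly_Mapping.lookup m j)"
  unfolding eval_monom_def using assms by (intro prod.mono_neutral_left) (auto simp: in_keys_iff)

lemma eval_monom_add: "eval_monom x (m + m') = eval_monom x m * eval_monom x m'"
proof -
  let ?A = "Poly_Mapping.keys m \<union> Poly_Mapping.keys m'"
  have "Poly_Mapping.keys (m + m') \<subseteq> ?A"
    by (rule Poly_Mapping.keys_add)
  then show ?thesis
    by (simp add: eval_monom_superset[of ?A] lookup_add power_add prod.distrib)
qed

text \<open>Keys vary with the polynomial and can disappear by cancellation. Summing over a common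
  finite set instead makes evaluation visibly linear in the coefficients.\<close>

lemma eval_mpoly_superset:
  assumes "finite A" "Poly_Mapping.keys p \<subseteq> A"
  shows "eval_mpoly x p = (\<Sum>m\<in>A. Poly_Mapping.lookup p m * eval_monom x m)"
  unfolding eval_mpoly_def eval_monom_def using assms
  by (intro sum.mono_neutral_left) (auto simp: in_keys_iff)

lemma eval_mpoly_zero: "eval_mpoly x 0 = 0"
  by (simp add: eval_mpoly_def)

lemma eval_mpoly_add: "eval_mpoly x (p + q) = eval_mpoly x p + eval_mpoly x q"
proof -
  let ?A = "Poly_Mapping.keys p \<union> Poly_Mapping.keys q"
  have "Poly_Mapping.keys (p + q) \<subseteq> ?A"
    by (rule Poly_Mapping.keys_add)
  then show ?thesis
    by (simp add: eval_mpoly_superset[of ?A] lookup_add distrib_right sum.distrib)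
qed

lemma eval_mpoly_uminus: "eval_mpoly x (- p) = - eval_mpoly x p"
  using eval_mpoly_add[of x p "- p"] by (simp add: eval_mpoly_zero eq_neg_iff_add_eq_0 add.commute)

lemma eval_mpoly_single: "eval_mpoly x (Poly_Mapping.single m c) = c * eval_monom x m"
  by (simp add: eval_mpoly_superset[of "{m}"])

lemma mpoly_induct [case_names zero add_single]:
  assumes "Q 0" "\<And>p m c. Q p \<Longrightarrow> Q (p + Poly_Mapping.single m c)"
  shows "Q (p :: 'b \<Rightarrow>\<^sub>0 'a::comm_monoid_add)"
proof (induction p rule: update_induct)
  case const
  then show ?case
    by (rule assms(1))
next
  case (update f a b)
  \<comment> \<open>The key \<open>a\<close> is fresh for \<open>f\<close>, so overwriting its value
    0 is the same as adding a term.\<close>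
  have "Poly_Mapping.update a b f = f + Poly_Mapping.single a b"
    using update.hyps by (intro poly_mapping_eqI)
      (simp add: update.rep_eq lookup_add lookup_single when_def in_keys_iff)
  then show ?case
    using assms(2) update.IH by simp
qed

text \<open>Induction on both factors reduces the claim to products of two single terms, where it is
  \<open>eval_monom_add\<close>.\<close>

lemma eval_mpoly_mult: "eval_mpoly x (p * q) = eval_mpoly x p * eval_mpoly x q"
proof (induction p rule: mpoly_induct)
  case (add_single p m c)
  have "eval_mpoly x (Poly_Mapping.single m c * q) = c * eval_monom x m * eval_mpoly x q"
  proof (induction q rule: mpoly_induct)
    case (add_single q m' c')
    then show ?case
      by (simp add: distrib_left eval_mpoly_add mult_single eval_mpoly_single eval_monom_add ac_simps)
  qed (simp add: eval_mpoly_zero)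
  then show ?case
    by (simp add: distrib_right eval_mpoly_add eval_mpoly_single add_single.IH)
qed (simp add: eval_mpoly_zero)

section \<open>Vanishing ideals and generators of bounded degree\<close>

text \<open>This allows vanishing to be tested on generators, by the minimality of
  \<open>genideal\<close>.\<close>

lemma ideal_vanishing_ideal:
  fixes X :: "(nat \<Rightarrow> 'a::{comm_ring, comm_monoid_mult}) set"
  shows "ideal (vanishing_ideal n X) (mpoly_ring n)"
proof -
  interpret cring "mpoly_ring n :: 'a mpoly ring"
    by (rule cring_mpoly_ring)
  have ops: "mult (mpoly_ring n) = ((*) :: 'a mpoly \<Rightarrow> _)" "add (mpoly_ring n) = ((+) :: 'a mpoly \<Rightarrow> _)"
    "\<zero>\<^bsub>mpoly_ring n\<^esub> = (0 :: 'a mpoly)"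
    by (simp_all add: mpoly_ring_def)
  have neg: "\<ominus>\<^bsub>mpoly_ring n\<^esub> p = - p" if "p \<in> carrier (mpoly_ring n)" for p :: "'a mpoly"
    using that l_neg[OF that] by (simp add: ops eq_neg_iff_add_eq_0)
  show ?thesis
  proof (rule idealI)
    show "subgroup (vanishing_ideal n X) (add_monoid (mpoly_ring n))"
    proof (rule add.subgroupI)
      show "vanishing_ideal n X \<noteq> {}"
        using zero_closed by (auto simp: vanishing_ideal_def ops eval_mpoly_zero)
    next
      fix p assume p: "p \<in> vanishing_ideal n X"
      then have "p \<in> carrier (mpoly_ring n)"
        by (simp add: vanishing_ideal_def)
      then show "\<ominus>\<^bsub>mpoly_ring n\<^esub> p \<in> vanishing_ideal n X"
        using p a_inv_closed[of p] by (simp add: vanishing_ideal_def neg eval_mpoly_uminus)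
    next
      fix p q assume "p \<in> vanishing_ideal n X" "q \<in> vanishing_ideal n X"
      then show "p \<oplus>\<^bsub>mpoly_ring n\<^esub> q \<in> vanishing_ideal n X"
        using a_closed[of p q] by (simp add: vanishing_ideal_def ops eval_mpoly_add)
    qed (auto simp: vanishing_ideal_def)
  next
    fix p q :: "'a mpoly" assume *: "p \<in> vanishing_ideal n X" "q \<in> carrier (mpoly_ring n)"
    then show "q \<otimes>\<^bsub>mpoly_ring n\<^esub> p \<in> vanishing_ideal n X"
      using m_closed[of q p] by (simp add: vanishing_ideal_def ops eval_mpoly_mult)
    show "p \<otimes>\<^bsub>mpoly_ring n\<^esub> q \<in> vanishing_ideal n X"
      using * m_closed[of p q] by (simp add: vanishing_ideal_def ops eval_mpoly_mult)
  qed (rule ring_axioms)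
qed

lemma keys_subset_monoms:
  assumes "p \<in> carrier (mpoly_ring n)" "total_degree p \<le> d"
  shows "Poly_Mapping.keys p \<subseteq> monoms n d"
  using assms by (auto simp: monoms_def mpoly_ring_def total_degree_def)

lemma gen_degree_le_obtains:
  assumes "gen_degree n I \<le> enat d"
  obtains G where "G \<subseteq> carrier (mpoly_ring n)" "genideal (mpoly_ring n) G = I"
    "\<And>p. p \<in> G \<Longrightarrow> total_degree p \<le> d"
proof -
  \<comment> \<open>Only a strict bound on an infimum yields a member of the family below the bound.
    Passing to \<open>Suc d\<close> loses nothing, since degrees are naturals.\<close>
  have "gen_degree n I < enat (Suc d)"
    using assms by (simp add: order_le_less_trans)
  then obtain G where G: "G \<subseteq> carrier (mpoly_ring n)" "genideal (mpoly_ring n) G = I"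
      and deg: "(SUP p\<in>G. enat (total_degree p)) < enat (Suc d)"
    unfolding gen_degree_def INF_less_iff by blast
  have "total_degree p \<le> d" if "p \<in> G" for p
    using le_less_trans[OF SUP_upper[OF that] deg] by simp
  then show ?thesis
    using that G by blast
qed

section \<open>The chain obtained by dropping vanishing conditions one point at a time\<close>

theorem theorem15:
  fixes n r d :: nat
    and P :: "nat \<Rightarrow> nat \<Rightarrow> 'a::{comm_ring, comm_monoid_mult}"
    and I :: "nat \<Rightarrow> 'a mpoly set"
  assumes artinian: "artinian_ring (coeff_ring :: 'a ring)"
    and points: "\<And>i. i \<in> {1..r} \<Longrightarrow> P i \<in> affine_space n"
    and distinct: "inj_on P {1..r}"
    and ideals: "\<And>i. i \<in> {1..r} \<Longrightarrow> ideal (I i) (mpoly_ring n)"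
    and covers_others: "\<And>i. i \<in> {1..r} \<Longrightarrow> covers n (I i) (P ` {1..r} - {P i})"
    and d: "enat d = (MAX i\<in>{1..r}. gen_degree n (I i))"
    and bound: "enat r \<ge> ring_length (coeff_ring :: 'a ring) * enat ((n + d) choose d) + 1"
  shows "\<exists>i\<in>{1..r}. covers n (I i) (P ` {1..r})"
proof (rule ccontr)
  assume none: "\<not> ?thesis"
  have "\<exists>p. Poly_Mapping.keys p \<subseteq> monoms n d \<and> eval_mpoly (P i) p \<noteq> 0 \<and>
      (\<forall>j\<in>{1..r} - {i}. eval_mpoly (P j) p = 0)" if i: "i \<in> {1..r}" for i
  proof -
    have "gen_degree n (I i) \<le> enat d"
      unfolding d using i by (intro Max_ge) auto
    then obtain G where G: "G \<subseteq> carrier (mpoly_ring n)" "genideal (mpoly_ring n) G = I i"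
        and deg: "\<And>p. p \<in> G \<Longrightarrow> total_degree p \<le> d"
      by (rule gen_degree_le_obtains) blast
    interpret cring "mpoly_ring n :: 'a mpoly ring"
      by (rule cring_mpoly_ring)
    have "\<not> I i \<subseteq> vanishing_ideal n (P ` {1..r})"
      using none i unfolding covers_def by blast
    \<comment> \<open>If all generators vanished at all the points, so would the ideal that they
      generate.\<close>
    then have "\<not> G \<subseteq> vanishing_ideal n (P ` {1..r})"
      using genideal_minimal[OF ideal_vanishing_ideal] G(2) by blast
    then obtain p j where p: "p \<in> G" "j \<in> {1..r}" "eval_mpoly (P j) p \<noteq> 0"
      using G(1) unfolding vanishing_ideal_def by blast
    have "p \<in> I i"
      using genideal_self[OF G(1)] G(2) p(1) by blast
    \<comment> \<open>Distinctness gives \<open>P k \<noteq> P i\<close>, so \<open>P k\<close> is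
      among the points that \<open>I i\<close> covers. Hence \<open>P i\<close> is the only point
      where \<open>p\<close> can be nonzero.\<close>
    then have vanish: "eval_mpoly (P k) p = 0" if "k \<in> {1..r} - {i}" for k
      using covers_others[OF i] that inj_onD[OF distinct, of k i] i
      unfolding covers_def vanishing_ideal_def by blast
    then have "j = i"
      using p by blast
    moreover have "Poly_Mapping.keys p \<subseteq> monoms n d"
      using p(1) G(1) deg by (intro keys_subset_monoms) auto
    ultimately show ?thesis
      using p(3) vanish by blast
  qed
  then have "\<forall>i\<in>{1..r}. \<exists>p. Poly_Mapping.keys p \<subseteq> monoms n d \<and> eval_mpoly (P i) p \<noteq> 0 \<and>
      (\<forall>j\<in>{1..r} - {i}. eval_mpoly (P j) p = 0)"
    by blast
  from bchoice[OF this] obtain f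
    where f: "\<forall>i\<in>{1..r}. Poly_Mapping.keys (f i) \<subseteq> monoms n d \<and> eval_mpoly (P i) (f i) \<noteq> 0 \<and>
      (\<forall>j\<in>{1..r} - {i}. eval_mpoly (P j) (f i) = 0)"
    by (rule exE)
  \<comment> \<open>Evaluation at \<open>P j\<close>, as a linear form on coefficient vectors
    indexed by monomials.\<close>
  let ?e = "\<lambda>v j. \<Sum>m\<in>monoms n d. v m * eval_monom (P j) m"
  define M where "M s = {v :: (nat \<Rightarrow>\<^sub>0 nat) \<Rightarrow> 'a. (\<forall>m. v m \<noteq> 0 \<longrightarrow> m \<in> monoms n d) \<and>
    (\<forall>j\<in>{s<..r}. ?e v j = 0)}" for s
  have "enat r \<le> ring_length (coeff_ring :: 'a ring) * enat (card (monoms n d))"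
  proof (rule strict_submodule_chain_length_le[of M])
    fix s
    have e: "?e (\<lambda>m. v m + w m) j = ?e v j + ?e w j" "?e (\<lambda>m. c * v m) j = c * ?e v j" for v w c j
      by (simp_all add: distrib_right sum.distrib sum_distrib_left mult.assoc)
    show "submodule_fun (M s)"
      unfolding submodule_fun_def
    proof (intro conjI ballI allI)
      show "(\<lambda>_. 0) \<in> M s"
        by (simp add: M_def)
      show "(\<lambda>m. v m + w m) \<in> M s" if "v \<in> M s" "w \<in> M s" for v w
      proof -
        have "m \<in> monoms n d" if "v m + w m \<noteq> 0" for m
          using \<open>v \<in> M s\<close> \<open>w \<in> M s\<close> that unfolding M_def by (cases "v m = 0") auto
        then show ?thesis
          using that by (simp add: M_def e)
      qed
      show "(\<lambda>m. c * v m) \<in> M s" if "v \<in> M s" for c v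
      proof -
        have "m \<in> monoms n d" if "c * v m \<noteq> 0" for m
          using \<open>v \<in> M s\<close> that unfolding M_def by (cases "v m = 0") auto
        then show ?thesis
          using that by (simp add: M_def e)
      qed
    qed
  next
    show "mono M"
      by (rule monoI) (auto simp: M_def)
  next
    fix s assume s: "s < r"
    \<comment> \<open>The condition at the point with index \<open>Suc s\<close> is the one that
      \<open>M s\<close> imposes and \<open>M (Suc s)\<close> does not. The polynomial
      \<open>f (Suc s)\<close> violates exactly this condition.\<close>
    let ?v = "Poly_Mapping.lookup (f (Suc s))"
    have fs: "Poly_Mapping.keys (f (Suc s)) \<subseteq> monoms n d" "eval_mpoly (P (Suc s)) (f (Suc s)) \<noteq> 0"
        "\<And>j. j \<in> {1..r} - {Suc s} \<Longrightarrow> eval_mpoly (P j) (f (Suc s)) = 0"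
      using bspec[OF f, of "Suc s"] s by simp_all
    have e: "?e ?v j = eval_mpoly (P j) (f (Suc s))" for j
      using eval_mpoly_superset[OF finite_monoms fs(1)] by simp
    have "m \<in> monoms n d" if "?v m \<noteq> 0" for m
      using fs(1) that by (auto simp: in_keys_iff)
    then have "?v \<in> M (Suc s)"
      unfolding M_def using fs(3) by (simp add: e)
    moreover have "?v \<notin> M s"
    proof
      assume "?v \<in> M s"
      then have "?e ?v (Suc s) = 0"
        using s unfolding M_def by simp
      then show False
        using fs(2) by (simp add: e)
    qed
    ultimately show "M s \<noteq> M (Suc s)"
      by blast
  next
    show "i \<in> monoms n d" if "v \<in> M s" "v i \<noteq> 0" for s v i
      using that unfolding M_def by blast
  qed (rule finite_monoms)
  also have "\<dots> \<le> ring_length (coeff_ring :: 'a ring) * enat ((n + d) choose d)"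
    using card_monoms_le by (intro mult_left_mono) simp_all
  finally have "enat r \<le> ring_length (coeff_ring :: 'a ring) * enat ((n + d) choose d)" .
  \<comment> \<open>In \<open>enat\<close> this needs the finiteness of \<open>enat r\<close>, which
    forces \<open>x\<close> to be finite; at infinity adding 1 changes nothing.\<close>
  moreover have "x + 1 \<le> enat r \<Longrightarrow> \<not> enat r \<le> x" for x
    by (cases x) (auto simp: one_enat_def)
  ultimately show False
    using bound by blast
qed

end
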